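(* Let $\bar\delta\in\mathbb{N}^n$ and let $C=F[-\bar\delta]/I$ be a regular monomial cyclic right module, that is, $I\subset F$ is a regular monomial right ideal. Then the multigraded Hilbert series $\mathrm{HS}(C)$ belongs to the rational function field $\mathbb{Q}(t_1,\ldots,t_n)$.
   Context: Let $\mathbb{K}$ be any field, $X=\{x_1,\ldots,x_n\}$ a finite set of variables, $W=X^*$ the free monoid of words over $X$, and $F=\mathbb{K}\langle X\rangle$ the free associative algebra, with $\mathbb{K}$-basis $W$. For $w\in W$, $\deg(w)=(\alpha_1,\ldots,\alpha_n)\in\mathbb{N}^n$ where $\alpha_i$ is the number of occurrences of $x_i$ in $w$. For $\bar\delta\in\mathbb{N}^n$, $F[-\bar\delta]$ is the right $F$-module $F$ multigraded by giving a word $w$ the multidegree $\bar\delta+\deg(w)$. A monomial right ideal of $F$ is a right ideal generated by a (possibly infinite) set of words; the quotient $F[-\bar\delta]/I$ by such an ideal inherits the multigrading and is called a monomial cyclic right module. The multigraded Hilbert series of a finitely generated multigraded right module $N$ is $\mathrm{HS}(N)=\sum_{\bar\alpha\in\mathbb{N}^n}\dim_{\mathbb{K}}N_{\bar\alpha}\,t_1^{\alpha_1}\cdots t_n^{\alpha_n}$; saying that it belongs to $\mathbb{Q}(t_1,\ldots,t_n)$ means that this power series is the expansion of a rational function with rational coefficients. Let $\mathcal{MI}$ be the set of all monomial right ideals of $F$. For each variable $x_i$, $T_{x_i}:\mathcal{MI}\to\mathcal{MI}$ is $T_{x_i}(I)=(I:_Rx_i)=\{f\in F\mid x_if\in I\}$.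 The orbit $\mathcal{O}_I$ of $I\in\mathcal{MI}$ is the minimal subset of $\mathcal{MI}$ containing $I$ with $T_{x_i}(\mathcal{O}_I)\subset\mathcal{O}_I$ for all $i$. The ideal $I$ is regular if $\mathcal{O}_I$ is finite. *)

theory Defs
  imports
    "HOL-Library.Poly_Mapping"
    "HOL-Library.Set_Algebras"
    "HOL-Computational_Algebra.Fraction_Field"
    "Jordan_Normal_Form.VS_Connect"
begin

section \<open>The free associative algebra\<close>

text \<open>
  Words over \<open>'x\<close> are lists. With the free monoid written additively, the convolution product
  of \<^theory>\<open>HOL-Library.Poly_Mapping\<close> turns the finitely supported functions
  \<open>'x list \<Rightarrow>\<^sub>0 'k\<close> into the free associative algebra.
\<close>

instantiation list :: (type) monoid_add
begin

definition zero_list :: "'a list" where "zero_list = []"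

definition plus_list :: "'a list \<Rightarrow> 'a list \<Rightarrow> 'a list" where "plus_list u v = u @ v"

instance by standard (simp_all add: zero_list_def plus_list_def)

end

type_synonym ('x, 'k) free_algebra = "'x list \<Rightarrow>\<^sub>0 'k"

type_synonym 'x multidegree = "'x \<Rightarrow>\<^sub>0 nat"

definition word :: "'x list \<Rightarrow> ('x, 'k::field) free_algebra" where
  "word w = Poly_Mapping.single w 1"

definition scalar :: "'k \<Rightarrow> ('x, 'k::field) free_algebra" where
  "scalar c = Poly_Mapping.single [] c"

lift_definition word_deg :: "'x list \<Rightarrow> 'x multidegree" is count_list
  by (rule finite_subset[of _ "set _"]) (auto simp: count_list_0_iff)

section \<open>Monomial right ideals, their orbits and regularity\<close>

definition right_ideal :: "('x, 'k::field) free_algebra set \<Rightarrow> bool" where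
  "right_ideal I \<longleftrightarrow> 0 \<in> I \<and> (\<forall>f\<in>I. \<forall>g\<in>I. f + g \<in> I) \<and> (\<forall>f\<in>I. \<forall>h. f * h \<in> I)"

definition monomial_right_ideals :: "('x, 'k::field) free_algebra set set" where
  "monomial_right_ideals = {right_ideal hull (word ` A) | A. True}"

definition colon_right ::
    "('x, 'k::field) free_algebra set \<Rightarrow> 'x \<Rightarrow> ('x, 'k) free_algebra set" where
  "colon_right I x = {f. word [x] * f \<in> I}"

lemma right_ideal_mult: "right_ideal I \<Longrightarrow> f \<in> I \<Longrightarrow> f * h \<in> I"
  by (simp add: right_ideal_def)

lemma right_ideal_uminus: "right_ideal I \<Longrightarrow> f \<in> I \<Longrightarrow> - f \<in> I"
  using right_ideal_mult[of I f "- 1"] by simp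

lemma poly_mapping_sum_singles:
  fixes f :: "'a \<Rightarrow>\<^sub>0 'b::comm_monoid_add"
  shows
  "(\<Sum>w\<in>Poly_Mapping.keys f. Poly_Mapping.single w (Poly_Mapping.lookup f w)) = f"
  by (rule poly_mapping_eqI) (auto simp: lookup_sum lookup_single when_def in_keys_iff)

lemma poly_mapping_sum_induct [case_names zero single add]:
  fixes f :: "'a \<Rightarrow>\<^sub>0 'b::comm_monoid_add"
  assumes "P 0" and "\<And>w a. P (Poly_Mapping.single w a)"
    and "\<And>f g. P f \<Longrightarrow> P g \<Longrightarrow> P (f + g)"
  shows "P f"
proof -
  have "P (\<Sum>w\<in>S. Poly_Mapping.single w (Poly_Mapping.lookup f w))" if "finite S" for S
    using that by induction (auto intro: assms)
  from this[of "Poly_Mapping.keys f"] show ?thesis by (simp add: poly_mapping_sum_singles)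
qed

lemma scalar_commute: "scalar c * f = f * scalar c"
proof (induction f rule: poly_mapping_sum_induct)
  case (single w a)
  have "[] + w = w + []" by (simp add: plus_list_def)
  then show ?case by (simp add: scalar_def mult_single mult.commute)
qed (simp_all add: distrib_left distrib_right)

lemma lookup_scalar_mult: "Poly_Mapping.lookup (scalar c * f) w = c * Poly_Mapping.lookup f w"
proof (induction f rule: poly_mapping_sum_induct)
  case (single v a)
  have "[] + v = v" by (simp add: plus_list_def)
  then show ?case by (simp add: scalar_def mult_single lookup_single when_def)
qed (simp_all add: distrib_left lookup_add)

lemma keys_word_mult: "Poly_Mapping.keys (word u * f) = (\<lambda>w. u @ w) ` Poly_Mapping.keys f"
proof -
  have *: "Poly_Mapping.lookup (word u * f) w =
      (if take (length u) w = u then Poly_Mapping.lookup f (drop (length u) w) else 0)" for w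
  proof (induction f rule: poly_mapping_sum_induct)
    case (single v a)
    have "u @ v = w \<longleftrightarrow> take (length u) w = u \<and> v = drop (length u) w"
      by (metis append_eq_conv_conj append_take_drop_id)
    then show ?case
      by (simp add: word_def mult_single lookup_single when_def plus_list_def)
  qed (simp_all add: distrib_left lookup_add)
  show ?thesis
  proof (intro equalityI subsetI)
    fix w assume "w \<in> Poly_Mapping.keys (word u * f)"
    then have "take (length u) w = u" "drop (length u) w \<in> Poly_Mapping.keys f"
      by (auto simp: in_keys_iff * split: if_splits)
    then show "w \<in> (\<lambda>w. u @ w) ` Poly_Mapping.keys f"
      by (metis append_take_drop_id imageI)
  next
    fix w assume "w \<in> (\<lambda>w. u @ w) ` Poly_Mapping.keys f"
    then show "w \<in> Poly_Mapping.keys (word u * f)"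
      by (auto simp: in_keys_iff *)
  qed
qed

lemma poly_mapping_in_ideal:
  assumes "right_ideal I" and "\<And>w. w \<in> Poly_Mapping.keys f \<Longrightarrow> word w \<in> I"
  shows "f \<in> I"
proof -
  have "Poly_Mapping.single w a \<in> I" if "w \<in> Poly_Mapping.keys f" for w a
  proof -
    have "w + [] = w" by (simp add: plus_list_def)
    then have "word w * scalar a = Poly_Mapping.single w a"
      by (simp add: word_def scalar_def mult_single)
    with assms that show ?thesis unfolding right_ideal_def by metis
  qed
  moreover have "(\<Sum>w\<in>S. g w) \<in> I" if "finite S" "\<And>w. w \<in> S \<Longrightarrow> g w \<in> I"
    for S :: "'a list set" and g
    using that by (induction) (use assms(1) in \<open>auto simp: right_ideal_def\<close>)
  ultimately have "(\<Sum>w\<in>Poly_Mapping.keys f. Poly_Mapping.single w (Poly_Mapping.lookup f w)) \<in> I"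
    by simp
  also have "(\<Sum>w\<in>Poly_Mapping.keys f. Poly_Mapping.single w (Poly_Mapping.lookup f w)) = f"
    by (rule poly_mapping_sum_singles)
  finally show ?thesis .
qed

lemma right_ideal_hull: "right_ideal (right_ideal hull S)"
  by (rule hull_in) (auto simp: right_ideal_def)

lemma monomial_right_ideal_eq:
  "right_ideal hull (word ` A) = {f. \<forall>w\<in>Poly_Mapping.keys f. \<exists>a\<in>A. \<exists>u. w = a @ u}"
    (is "_ = ?J")
proof
  have "right_ideal ?J"
    unfolding right_ideal_def
  proof (intro conjI ballI allI)
    fix f g assume "f \<in> ?J" "g \<in> ?J"
    then show "f + g \<in> ?J" using keys_add[of f g] by blast
  next
    fix f h assume f: "f \<in> ?J"
    have "\<exists>a\<in>A. \<exists>u. w = a @ u" if "w \<in> Poly_Mapping.keys (f * h)" for w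
    proof -
      from that obtain v u where "v \<in> Poly_Mapping.keys f" "w = v @ u"
        using keys_mult[of f h] by (auto simp: plus_list_def)
      with f show ?thesis by fastforce
    qed
    then show "f * h \<in> ?J" by simp
  qed simp
  moreover have "word ` A \<subseteq> ?J" by (auto simp: word_def) (metis append_Nil2)
  ultimately show "right_ideal hull (word ` A) \<subseteq> ?J" by (rule hull_minimal[rotated])
next
  show "?J \<subseteq> right_ideal hull (word ` A)"
  proof
    fix f assume f: "f \<in> ?J"
    show "f \<in> right_ideal hull (word ` A)"
    proof (rule poly_mapping_in_ideal[OF right_ideal_hull])
      fix w assume "w \<in> Poly_Mapping.keys f"
      then obtain a u where "a \<in> A" "w = a @ u" using f by blast
      then have "word a \<in> right_ideal hull (word ` A)"
        using hull_subset[of "word ` A" right_ideal] by blast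
      then have "word a * word u \<in> right_ideal hull (word ` A)"
        by (rule right_ideal_mult[OF right_ideal_hull])
      also have "word a * word u = word w"
        using \<open>w = a @ u\<close> by (simp add: word_def mult_single plus_list_def)
      finally show "word w \<in> right_ideal hull (word ` A)" .
    qed
  qed
qed

lemma colon_right_monomial:
  assumes "I \<in> monomial_right_ideals"
  shows "colon_right I x \<in> monomial_right_ideals"
proof -
  from assms obtain A where I: "I = right_ideal hull (word ` A)"
    by (auto simp: monomial_right_ideals_def)
  let ?B = "{w. \<exists>a\<in>A. \<exists>u. x # w = a @ u}"
  have "colon_right I x = right_ideal hull (word ` ?B)"
  proof -
    have *: "(\<exists>a\<in>A. \<exists>u. x # w = a @ u) \<longleftrightarrow> (\<exists>b\<in>?B. \<exists>u. w = b @ u)" for w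
    proof
      show "\<exists>a\<in>A. \<exists>u. x # w = a @ u \<Longrightarrow> \<exists>b\<in>?B. \<exists>u. w = b @ u"
        by (rule bexI[of _ w]) auto
      assume "\<exists>b\<in>?B. \<exists>u. w = b @ u"
      then obtain b u a v where "a \<in> A" "x # b = a @ v" "w = b @ u" by blast
      then have "x # w = a @ (v @ u)" by (metis append_Cons append_assoc)
      with \<open>a \<in> A\<close> show "\<exists>a\<in>A. \<exists>u. x # w = a @ u" by blast
    qed
    have "colon_right I x = {f. \<forall>w\<in>Poly_Mapping.keys f. \<exists>a\<in>A. \<exists>u. x # w = a @ u}"
      unfolding I monomial_right_ideal_eq colon_right_def by (simp add: keys_word_mult)
    also have "\<dots> = right_ideal hull (word ` ?B)"
      unfolding monomial_right_ideal_eq by (intro Collect_cong ball_cong refl *)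
    finally show ?thesis .
  qed
  then show ?thesis by (auto simp: monomial_right_ideals_def)
qed

definition orbit ::
    "('x, 'k::field) free_algebra set \<Rightarrow> ('x, 'k) free_algebra set set" where
  "orbit I = \<Inter> {S. S \<subseteq> monomial_right_ideals \<and> I \<in> S \<and> (\<forall>J\<in>S. \<forall>x. colon_right J x \<in> S)}"

definition regular_ideal :: "('x, 'k::field) free_algebra set \<Rightarrow> bool" where
  "regular_ideal I \<longleftrightarrow> finite (orbit I)"

section \<open>Monomial cyclic right modules and their Hilbert series\<close>

text \<open>
  The elements of \<open>F/I\<close> are the cosets \<open>f +o I\<close>. Only the \<open>'k\<close>-linear structure of the quotient
  is recorded, as this is what the Hilbert series refers to; the fields \<open>mult\<close> and \<open>one\<close> of the
  module record have no meaning for a module.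
\<close>

definition quotient_module ::
    "('x, 'k::field) free_algebra set \<Rightarrow> ('k, ('x, 'k) free_algebra set) module" where
  "quotient_module I =
     \<lparr>carrier = range (\<lambda>f. f +o I), monoid.mult = undefined, one = undefined,
      zero = I, add = (+),
      module.smult = (\<lambda>c A. (\<lambda>f. scalar c * f) ` A + I)\<rparr>"

definition shifted_component ::
    "'x multidegree \<Rightarrow> 'x multidegree \<Rightarrow> ('x, 'k::field) free_algebra set" where
  "shifted_component \<delta> \<alpha> = {f. \<forall>w\<in>Poly_Mapping.keys f. \<delta> + word_deg w = \<alpha>}"

text \<open>The multigraded component of \<open>F[-\<delta>]/I\<close> is the image of that of \<open>F[-\<delta>]\<close>.\<close>

definition cyclic_module ::
    "'x multidegree \<Rightarrow> ('x, 'k::field) free_algebra set \<Rightarrow>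
     'x multidegree \<Rightarrow> ('k, ('x, 'k) free_algebra set) module" where
  "cyclic_module \<delta> I \<alpha> =
     (quotient_module I)\<lparr>carrier := (\<lambda>f. f +o I) ` shifted_component \<delta> \<alpha>\<rparr>"

lemma coset_add:
  assumes "right_ideal I"
  shows "(f +o I) + (g +o I) = (f + g) +o I"
proof -
  have "I + I = I"
  proof
    show "I + I \<subseteq> I" using assms by (auto simp: right_ideal_def elim!: set_plus_elim)
    show "I \<subseteq> I + I"
    proof
      fix i assume "i \<in> I"
      moreover have "0 \<in> I" using assms by (simp add: right_ideal_def)
      ultimately have "i + 0 \<in> I + I" by (rule set_plus_intro)
      then show "i \<in> I + I" by simp
    qed
  qed
  moreover have "(f +o I) + (g +o I) = (f + g) +o (I + I)"
    by (rule set_plus_rearrange)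
  ultimately show ?thesis by (simp only:)
qed

lemma coset_smult:
  assumes "right_ideal I"
  shows "(\<lambda>h. scalar c * h) ` (f +o I) + I = (scalar c * f) +o I"
proof
  have c: "scalar c * i + j \<in> I" if "i \<in> I" "j \<in> I" for i j
    using assms that by (auto simp: right_ideal_def scalar_commute)
  show "(\<lambda>h. scalar c * h) ` (f +o I) + I \<subseteq> (scalar c * f) +o I"
    using c by (auto simp: set_plus_def elt_set_plus_def algebra_simps)
  have "f \<in> f +o I" using assms by (force simp: elt_set_plus_def right_ideal_def)
  then show "(scalar c * f) +o I \<subseteq> (\<lambda>h. scalar c * h) ` (f +o I) + I"
    by (auto simp: set_plus_def elt_set_plus_def[of "scalar c * f"])
qed

lemma vectorspace_cyclic_module:
  assumes I: "right_ideal I"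
  shows "vectorspace class_ring (cyclic_module \<delta> I \<alpha>)"
proof -
  let ?V = "shifted_component \<delta> \<alpha> :: ('a, 'b) free_algebra set"
  let ?M = "cyclic_module \<delta> I \<alpha>"
  have V0: "0 \<in> ?V" by (simp add: shifted_component_def)
  have Vadd: "f + g \<in> ?V" if "f \<in> ?V" "g \<in> ?V" for f g
    using that keys_add[of f g] by (auto simp: shifted_component_def)
  have Vs: "scalar c * f \<in> ?V" if "f \<in> ?V" for c f
    using that by (auto simp: shifted_component_def in_keys_iff lookup_scalar_mult)
  have Vm: "- f \<in> ?V" if "f \<in> ?V" for f
    using that by (auto simp: shifted_component_def in_keys_iff)
  have s: "scalar (a + b) = (scalar a + scalar b :: ('a, 'b) free_algebra)"
      "scalar (a * b) = (scalar a * scalar b :: ('a, 'b) free_algebra)"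
      "scalar 1 = (1 :: ('a, 'b) free_algebra)" for a b
  proof -
    have "[] + [] = ([] :: 'a list)" by (simp add: plus_list_def)
    then show "scalar (a + b) = (scalar a + scalar b :: ('a, 'b) free_algebra)"
      "scalar (a * b) = (scalar a * scalar b :: ('a, 'b) free_algebra)"
      "scalar 1 = (1 :: ('a, 'b) free_algebra)"
      by (simp_all add: scalar_def single_add mult_single flip: zero_list_def single_one)
  qed
  have car: "carrier ?M = (\<lambda>f. f +o I) ` ?V" and z: "zero ?M = 0 +o I"
    and add: "(f +o I) \<oplus>\<^bsub>?M\<^esub> (g +o I) = (f + g) +o I"
    and sm: "c \<odot>\<^bsub>?M\<^esub> (f +o I) = (scalar c * f) +o I" for f g c
    by (simp_all add: cyclic_module_def quotient_module_def coset_add[OF I] coset_smult[OF I])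
  have "abelian_group ?M"
  proof (rule abelian_groupI)
    show "\<zero>\<^bsub>?M\<^esub> \<in> carrier ?M" using V0 unfolding car z by blast
    fix x assume "x \<in> carrier ?M"
    then obtain f where f: "f \<in> ?V" "x = f +o I" by (auto simp: car)
    then show "\<exists>y\<in>carrier ?M. y \<oplus>\<^bsub>?M\<^esub> x = \<zero>\<^bsub>?M\<^esub>"
      by (intro bexI[of _ "(- f) +o I"]) (auto simp: z add car Vm simp del: set_zero_plus)
  qed (auto simp: car z add Vadd add_ac simp del: set_zero_plus)
  then have "module class_ring ?M"
    by (intro moduleI class_cring.cring_axioms)
       (auto simp: car add sm Vs Vadd s algebra_simps)
  then show ?thesis
    by (simp add: vectorspace_def class_field.field_axioms)
qed

text \<open>A multivariate power series is the function giving its coefficients.\<close>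

definition hilbert_series ::
    "('x multidegree \<Rightarrow> ('k::field, 'v) module) \<Rightarrow> 'x multidegree \<Rightarrow> rat" where
  "hilbert_series N \<alpha> = of_nat (vectorspace.dim class_ring (N \<alpha>))"

section \<open>Rational functions and their expansions\<close>

text \<open>
  The linear order on the variables serves only to obtain from the library that the polynomials
  form an integral domain.
\<close>

type_synonym 'x rational_function = "('x multidegree \<Rightarrow>\<^sub>0 rat) fract"

text \<open>
  \<open>P/Q\<close> has a power series expansion if the constant term of \<open>Q\<close> does not vanish, and the
  expansion \<open>H\<close> is then determined by \<open>Q H = P\<close>.
\<close>

definition is_expansion ::
    "('x::linorder multidegree \<Rightarrow> rat) \<Rightarrow> 'x rational_function \<Rightarrow> bool" where
  "is_expansion H r \<longleftrightarrow>
     (\<exists>P Q. Poly_Mapping.lookup Q 0 \<noteq> 0 \<and> r = Fract P Q \<and>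
        (\<forall>\<alpha>. (\<Sum>(\<beta>, \<gamma>) \<in> {(\<beta>, \<gamma>). \<beta> + \<gamma> = \<alpha>}. Poly_Mapping.lookup Q \<beta> * H \<gamma>)
             = Poly_Mapping.lookup P \<alpha>))"

lemma finite_multidegree_decompositions:
  fixes \<alpha> :: "'x::finite multidegree"
  shows "finite {(\<beta>, \<gamma>). \<beta> + \<gamma> = \<alpha>}"
proof -
  have "finite {f :: 'x \<Rightarrow> nat. \<forall>x. f x \<in> {..Poly_Mapping.lookup \<alpha> x}}"
    using finite_PiE[of UNIV "\<lambda>x. {..Poly_Mapping.lookup \<alpha> x}"]
    by (simp add: PiE_def Pi_def extensional_def)
  then have "finite (Poly_Mapping.lookup ` {\<beta>. \<forall>x. Poly_Mapping.lookup \<beta> x \<in> {..Poly_Mapping.lookup \<alpha> x}})"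
    by (rule finite_subset[rotated]) auto
  then have "finite {\<beta>. \<forall>x. Poly_Mapping.lookup \<beta> x \<in> {..Poly_Mapping.lookup \<alpha> x}}"
    by (rule finite_imageD) (simp add: inj_on_def)
  then have "finite ((\<lambda>\<beta>. (\<beta>, \<alpha> - \<beta>)) ` \<dots>)" by simp
  then show ?thesis
    by (rule finite_subset[rotated]) (auto simp: lookup_add)
qed

end

theory Submission
  imports Defs
begin

text \<open>
  The words outside \<open>I\<close> form a basis of \<open>F/I\<close>, so the Hilbert series of \<open>I\<close> counts them by
  multidegree. Splitting off the first letter \<open>x\<close> of a word outside \<open>J\<close> leaves a word outside
  \<open>colon_right J x\<close>, which yields a linear system between the series of the ideals in the orbit.
  Its matrix is the identity plus polynomials without constant term. Gaussian elimination without
  division keeps the constant terms on the diagonal nonzero and those off the diagonal zero, and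
  it ends with an equation \<open>Q H = P\<close> for the series \<open>H\<close> of \<open>I\<close>.
\<close>

section \<open>Dimensions of the components\<close>

lemma single_eq_scalar_word: "Poly_Mapping.single w c = scalar c * word w"
proof -
  have "[] + w = w" by (simp add: plus_list_def)
  then show ?thesis by (simp add: scalar_def word_def mult_single)
qed

lemma word_append: "word (u @ v) = word u * word v"
  by (simp add: word_def mult_single plus_list_def)

lemma coset_eq_iff:
  assumes "right_ideal I"
  shows "f +o I = g +o I \<longleftrightarrow> f - g \<in> I"
proof
  assume "f +o I = g +o I"
  moreover have "f \<in> f +o I"
    using assms by (force simp: elt_set_plus_def right_ideal_def)
  ultimately show "f - g \<in> I" by (auto simp: elt_set_plus_def)
next
  have *: "f +o I \<subseteq> g +o I" if "f - g \<in> I" for f g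
  proof
    fix h assume "h \<in> f +o I"
    then obtain i where "i \<in> I" "h = g + (f - g + i)" by (auto simp: elt_set_plus_def)
    with that assms show "h \<in> g +o I" unfolding right_ideal_def elt_set_plus_def by blast
  qed
  assume fg: "f - g \<in> I"
  then have "g - f \<in> I" using right_ideal_uminus[OF assms fg] by simp
  with fg show "f +o I = g +o I" using * by blast
qed

lemma monomial_ideal_right_ideal: "I \<in> monomial_right_ideals \<Longrightarrow> right_ideal I"
  by (auto simp: monomial_right_ideals_def right_ideal_hull)

text \<open>Every word in the support of an element of a monomial ideal extends a generating word,
  so it lies in the ideal itself. This ties membership in \<open>I\<close> to single words.\<close>

lemma monomial_ideal_keys:
  assumes "I \<in> monomial_right_ideals" "f \<in> I" "w \<in> Poly_Mapping.keys f"
  shows "word w \<in> I"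
proof -
  from assms(1) obtain A where A: "I = right_ideal hull (word ` A)"
    by (auto simp: monomial_right_ideals_def)
  from assms(2,3) show ?thesis
    unfolding A monomial_right_ideal_eq by (simp add: word_def)
qed

text \<open>If two distinct words had the same coset, their difference would lie in \<open>I\<close>
  and have the first word in its support. Injectivity lets the cosets be indexed by words in the
  dimension count.\<close>

lemma inj_on_normal_word_cosets:
  assumes I: "I \<in> monomial_right_ideals" and B: "\<And>w. w \<in> B \<Longrightarrow> word w \<notin> I"
  shows "inj_on (\<lambda>w. word w +o I) B"
proof (rule inj_onI, rule ccontr)
  fix v w assume vw: "v \<in> B" "w \<in> B" "word v +o I = word w +o I" "v \<noteq> w"
  then have "word v - word w \<in> I"
    using coset_eq_iff[OF monomial_ideal_right_ideal[OF I]] by blast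
  moreover have "v \<in> Poly_Mapping.keys (word v - word w :: ('a, 'b) free_algebra)"
    using vw by (simp add: in_keys_iff lookup_minus word_def lookup_single)
  ultimately have "word v \<in> I" by (rule monomial_ideal_keys[OF I])
  with B vw show False by blast
qed

lemma sum_word_deg:
  "(\<Sum>x\<in>UNIV. Poly_Mapping.lookup (word_deg w) x) = length (w :: 'x::finite list)"
  by (simp add: word_deg.rep_eq sum_count_set)

text \<open>The length of a word is its total degree, hence at most that of \<alpha>, and a finite
  alphabet has finitely many words of bounded length.\<close>

lemma finite_words_of_degree: "finite {w :: 'x::finite list. \<delta> + word_deg w = \<alpha>}"
proof (rule finite_subset)
  let ?N = "\<Sum>x\<in>UNIV. Poly_Mapping.lookup \<alpha> x"
  show "{w :: 'x list. \<delta> + word_deg w = \<alpha>} \<subseteq> {w. set w \<subseteq> UNIV \<and> length w \<le> ?N}"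
    by (auto simp: lookup_add sum.distrib sum_word_deg)
  show "finite {w :: 'x list. set w \<subseteq> UNIV \<and> length w \<le> ?N}"
    by (rule finite_lists_length_le) simp
qed

text \<open>Independence holds because elements of \<open>I\<close> are supported on words of
  \<open>I\<close>; the cosets span because dropping the words of \<open>I\<close> from a polynomial
  does not change its coset.\<close>

lemma dim_cyclic_module:
  fixes I :: "('x::finite, 'k::field) free_algebra set"
  assumes I: "I \<in> monomial_right_ideals"
  shows "vectorspace.dim class_ring (cyclic_module \<delta> I \<alpha>)
    = card {w. word w \<notin> I \<and> \<delta> + word_deg w = \<alpha>}"
proof -
  define M where "M = cyclic_module \<delta> I \<alpha>"
  define B where "B = {w. word w \<notin> I \<and> \<delta> + word_deg w = \<alpha>}"
  define b where "b w = word w +o I" for w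
  note R = monomial_ideal_right_ideal[OF I]
  interpret V: vectorspace class_ring M
    unfolding M_def by (rule vectorspace_cyclic_module[OF R])
  have car: "carrier M = (\<lambda>f. f +o I) ` shifted_component \<delta> \<alpha>"
    and zero: "zero M = 0 +o I"
    and add: "(f +o I) \<oplus>\<^bsub>M\<^esub> (g +o I) = (f + g) +o I"
    and smult: "c \<odot>\<^bsub>M\<^esub> (f +o I) = (scalar c * f) +o I" for f g c
    by (simp_all add: M_def cyclic_module_def quotient_module_def coset_add[OF R] coset_smult[OF R])
  have finB: "finite B"
    unfolding B_def by (rule finite_subset[OF _ finite_words_of_degree[of \<delta> \<alpha>]]) auto
  have inj: "inj_on b B"
    unfolding b_def by (rule inj_on_normal_word_cosets[OF I]) (simp add: B_def)
  have single_car: "Poly_Mapping.single w c +o I \<in> carrier M" if "w \<in> B" for w c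
    using that by (auto simp: car shifted_component_def B_def)
  have bB: "b ` B \<subseteq> carrier M"
    using single_car[of _ 1] by (auto simp: b_def word_def)
  have lookup_sum_B: "Poly_Mapping.lookup (\<Sum>w\<in>B. Poly_Mapping.single w (c w)) v
      = (if v \<in> B then c v else 0)" for c :: "'x list \<Rightarrow> 'k" and v
    using finB by (simp add: lookup_sum lookup_single when_def)
  \<comment> \<open>Coefficients are indexed by cosets. Through the injection \<open>b\<close> a
    linear combination becomes the coset of one polynomial, so that its vanishing means membership
    in \<open>I\<close>.\<close>
  have lincomb: "V.lincomb a (b ` B) = (\<Sum>w\<in>B. Poly_Mapping.single w (a (b w))) +o I" for a
  proof -
    have smult_b: "a (b w) \<odot>\<^bsub>M\<^esub> b w = Poly_Mapping.single w (a (b w)) +o I" for w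
      by (simp only: single_eq_scalar_word b_def smult)
    have "finsum M (\<lambda>v. a v \<odot>\<^bsub>M\<^esub> v) (b ` C) = (\<Sum>w\<in>C. Poly_Mapping.single w (a (b w))) +o I"
      if "finite C" "C \<subseteq> B" for C
      using that
    proof induction
      case empty
      then show ?case by (simp add: zero del: set_zero_plus)
    next
      case (insert w C)
      have "b w \<notin> b ` C"
        using insert inj by (metis inj_on_image_mem_iff insert_subset)
      moreover have "(\<lambda>v. a v \<odot>\<^bsub>M\<^esub> v) \<in> b ` C \<rightarrow> carrier M"
        using insert single_car by (auto simp: smult_b)
      moreover have "a (b w) \<odot>\<^bsub>M\<^esub> b w \<in> carrier M"
        using insert single_car by (auto simp: smult_b)
      ultimately show ?case
        using insert by (simp add: V.finsum_insert smult_b add)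
    qed
    from this[OF finB] show ?thesis by (simp add: V.lincomb_def)
  qed
  have "V.lin_indpt (b ` B)"
  proof (rule V.finite_lin_indpt2)
    fix a assume "V.lincomb a (b ` B) = \<zero>\<^bsub>M\<^esub>"
    then have I': "(\<Sum>w\<in>B. Poly_Mapping.single w (a (b w))) \<in> I"
      unfolding lincomb zero coset_eq_iff[OF R] by simp
    show "\<forall>v\<in>b ` B. a v = \<zero>\<^bsub>class_ring\<^esub>"
    proof (rule ballI, rule ccontr)
      fix v assume "v \<in> b ` B" "a v \<noteq> \<zero>\<^bsub>class_ring\<^esub>"
      then obtain w where "w \<in> B" "a (b w) \<noteq> 0" by auto
      then have "word w \<in> I"
        by (intro monomial_ideal_keys[OF I I']) (simp add: in_keys_iff lookup_sum_B)
      with \<open>w \<in> B\<close> show False by (simp add: B_def)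
    qed
  qed (use finB bB in auto)
  moreover have "V.span (b ` B) = carrier M"
  proof
    show "V.span (b ` B) \<subseteq> carrier M" using bB by (rule V.span_is_subset2)
    show "carrier M \<subseteq> V.span (b ` B)"
    proof
      fix m assume "m \<in> carrier M"
      then obtain f where f: "f \<in> shifted_component \<delta> \<alpha>" "m = f +o I" by (auto simp: car)
      \<comment> \<open>The inverse of \<open>b\<close> recovers the word from its coset, so
        \<open>a\<close> reads off the coefficient of \<open>f\<close> at that word.\<close>
      define a where "a v = Poly_Mapping.lookup f (inv_into B b v)" for v
      \<comment> \<open>The subtraction removes the words of \<open>B\<close> from \<open>f\<close>.
        The remaining words have the right degree, so they can only be outside \<open>B\<close> by
        lying in \<open>I\<close>.\<close>
      have "f - (\<Sum>w\<in>B. Poly_Mapping.single w (a (b w))) \<in> I"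
      proof (rule poly_mapping_in_ideal[OF R])
        fix w assume "w \<in> Poly_Mapping.keys (f - (\<Sum>w\<in>B. Poly_Mapping.single w (a (b w))))"
        then have "w \<notin> B" "w \<in> Poly_Mapping.keys f"
          by (auto simp: in_keys_iff lookup_minus lookup_sum_B a_def inv_into_f_f[OF inj]
              split: if_splits)
        with f show "word w \<in> I" by (auto simp: B_def shifted_component_def)
      qed
      then have "m = V.lincomb a (b ` B)"
        unfolding lincomb f coset_eq_iff[OF R] .
      then show "m \<in> V.span (b ` B)"
        using finB bB by (auto simp: V.finite_span)
    qed
  qed
  ultimately have "V.basis (b ` B)" using bB by (simp add: V.basis_def)
  then have "V.dim = card (b ` B)" using finB by (intro V.dim_basis) auto
  also have "\<dots> = card B" by (rule card_image[OF inj])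
  finally show ?thesis by (simp add: M_def B_def)
qed

section \<open>The action of polynomials on power series\<close>

text \<open>The product of a polynomial and a power series, written as the very sum in
  \<open>is_expansion\<close>. It makes the series a module over the polynomial ring.\<close>

definition series_mult ::
    "('x multidegree \<Rightarrow>\<^sub>0 rat) \<Rightarrow> ('x multidegree \<Rightarrow> rat) \<Rightarrow> 'x multidegree \<Rightarrow> rat" where
  "series_mult Q H \<alpha> =
     (\<Sum>(\<beta>, \<gamma>) \<in> {(\<beta>, \<gamma>). \<beta> + \<gamma> = \<alpha>}. Poly_Mapping.lookup Q \<beta> * H \<gamma>)"

lemma series_mult_zero [simp]: "series_mult 0 H = (\<lambda>\<alpha>. 0)"
  by (simp add: series_mult_def fun_eq_iff)

lemma series_mult_zero_right [simp]: "series_mult Q (\<lambda>\<alpha>. 0) = (\<lambda>\<alpha>. 0)"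
  by (simp add: series_mult_def fun_eq_iff)

lemma series_mult_add_left:
  "series_mult (P + Q) H \<alpha> = series_mult P H \<alpha> + series_mult Q H \<alpha>"
  by (simp add: series_mult_def lookup_add distrib_right sum.distrib case_prod_unfold)

lemma series_mult_diff_left:
  "series_mult (P - Q) H \<alpha> = series_mult P H \<alpha> - series_mult Q H \<alpha>"
  by (simp add: series_mult_def lookup_minus left_diff_distrib sum_subtractf case_prod_unfold)

lemma series_mult_add_right:
  "series_mult Q (\<lambda>\<alpha>. G \<alpha> + H \<alpha>) \<alpha> = series_mult Q G \<alpha> + series_mult Q H \<alpha>"
  by (simp add: series_mult_def distrib_left sum.distrib case_prod_unfold)

lemma series_mult_sum_left:
  "series_mult (\<Sum>s\<in>S. P s) H \<alpha> = (\<Sum>s\<in>S. series_mult (P s) H \<alpha>)"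
  by (induction S rule: infinite_finite_induct) (simp_all add: series_mult_add_left)

lemma series_mult_sum_right:
  "series_mult Q (\<lambda>\<alpha>. \<Sum>s\<in>S. H s \<alpha>) \<alpha> = (\<Sum>s\<in>S. series_mult Q (H s) \<alpha>)"
  by (induction S rule: infinite_finite_induct) (simp_all add: series_mult_add_right)

text \<open>By cancellation the only decomposition of \<beta> + \<gamma> with first part \<beta> is
  (\<beta>, \<gamma>); a monomial therefore shifts the coefficients by its exponent.\<close>

lemma series_mult_single:
  fixes H :: "'x::finite multidegree \<Rightarrow> rat"
  shows "series_mult (Poly_Mapping.single \<beta> c) H (\<beta> + \<gamma>) = c * H \<gamma>"
proof -
  have "series_mult (Poly_Mapping.single \<beta> c) H (\<beta> + \<gamma>)
      = (\<Sum>(\<beta>', \<gamma>') \<in> {(\<beta>, \<gamma>)}. Poly_Mapping.lookup (Poly_Mapping.single \<beta> c) \<beta>' * H \<gamma>')"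
    unfolding series_mult_def
    by (rule sum.mono_neutral_right)
       (auto simp: finite_multidegree_decompositions lookup_single when_def split: if_splits)
  then show ?thesis by simp
qed

lemma series_mult_single_0:
  assumes "\<And>\<gamma>. \<alpha> \<noteq> \<beta> + \<gamma>"
  shows "series_mult (Poly_Mapping.single \<beta> c) H \<alpha> = 0"
  unfolding series_mult_def
  by (rule sum.neutral) (use assms in \<open>auto simp: lookup_single when_def\<close>)

lemma series_mult_one [simp]:
  fixes H :: "'x::finite multidegree \<Rightarrow> rat"
  shows "series_mult 1 H = H"
proof
  show "series_mult 1 H \<alpha> = H \<alpha>" for \<alpha>
    using series_mult_single[of 0 1 H \<alpha>] by simp
qed

text \<open>Both sides are additive in \<open>P\<close> and in \<open>Q\<close>, which reduces the
  claim to two monomials, that is, to two successive shifts.\<close>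

lemma series_mult_mult:
  fixes H :: "'x::finite multidegree \<Rightarrow> rat"
  shows "series_mult (P * Q) H = series_mult P (series_mult Q H)"
proof (induction P rule: poly_mapping_sum_induct)
  case (single a c)
  show ?case
  proof (induction Q rule: poly_mapping_sum_induct)
    case (single b d)
    show ?case
    proof
      fix \<alpha>
      \<comment> \<open>Either both shifts can be undone at \<alpha>, or only the one by
        \<open>a\<close>, or not even that one. In the last two cases both sides are zero.\<close>
      consider \<gamma> where "\<alpha> = a + (b + \<gamma>)"
        | \<gamma> where "\<alpha> = a + \<gamma>" "\<And>\<gamma>'. \<gamma> \<noteq> b + \<gamma>'"
        | "\<And>\<gamma>. \<alpha> \<noteq> a + \<gamma>" by metis
      then show "series_mult (Poly_Mapping.single a c * Poly_Mapping.single b d) H \<alpha>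
        = series_mult (Poly_Mapping.single a c) (series_mult (Poly_Mapping.single b d) H) \<alpha>"
      proof cases
        case 1
        then show ?thesis
          by (simp add: mult_single series_mult_single flip: add.assoc)
             (simp add: add.assoc series_mult_single)
      next
        case 2
        then have "\<alpha> \<noteq> a + b + \<gamma>'" for \<gamma>' by (auto simp: add.assoc)
        with 2 show ?thesis
          by (simp add: mult_single series_mult_single_0 series_mult_single)
      next
        case 3
        then have "\<alpha> \<noteq> a + b + \<gamma>'" for \<gamma>' by (auto simp: add.assoc)
        with 3 show ?thesis by (simp add: mult_single series_mult_single_0)
      qed
    qed
  qed (simp_all add: fun_eq_iff distrib_left series_mult_add_left
      flip: series_mult_add_right)
qed (simp_all add: fun_eq_iff distrib_right series_mult_add_left)

text \<open>The coefficient function of \<open>P\<close> is \<open>P\<close> acting on the series 1,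
  so the claim is the associativity of the action applied to that series.\<close>

lemma series_mult_lookup:
  fixes P Q :: "'x::finite multidegree \<Rightarrow>\<^sub>0 rat"
  shows "series_mult Q (Poly_Mapping.lookup P) = Poly_Mapping.lookup (Q * P)"
proof -
  have "series_mult P (Poly_Mapping.lookup 1) = Poly_Mapping.lookup P" for P :: "'x multidegree \<Rightarrow>\<^sub>0 rat"
  proof
    fix \<alpha>
    have "series_mult P (Poly_Mapping.lookup 1) \<alpha>
        = (\<Sum>(\<beta>, \<gamma>) \<in> {(\<alpha>, 0 :: 'x multidegree)}. Poly_Mapping.lookup P \<beta> * Poly_Mapping.lookup 1 \<gamma>)"
      unfolding series_mult_def
      by (rule sum.mono_neutral_right)
         (auto simp: finite_multidegree_decompositions lookup_one when_def
             split: if_splits)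
    then show "series_mult P (Poly_Mapping.lookup 1) \<alpha> = Poly_Mapping.lookup P \<alpha>" by simp
  qed
  then show ?thesis by (metis series_mult_mult)
qed

text \<open>In exponents over the naturals 0 decomposes only as 0 + 0. This controls the constant
  terms during elimination.\<close>

lemma lookup_mult_zero:
  fixes P Q :: "'x::finite multidegree \<Rightarrow>\<^sub>0 rat"
  shows "Poly_Mapping.lookup (P * Q) 0 = Poly_Mapping.lookup P 0 * Poly_Mapping.lookup Q 0"
proof -
  have "{(\<beta>, \<gamma>). \<beta> + \<gamma> = (0 :: 'x multidegree)} = {(0, 0)}"
    by (auto simp: poly_mapping_eq_iff fun_eq_iff lookup_add)
  then show ?thesis
    by (simp add: series_mult_def flip: series_mult_lookup)
qed

text \<open>Induction on the number of unknowns, removing some \<open>p\<close> other than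
  \<open>r\<close> each time. The hypothesis on \<open>M\<close> says that at t = 0 the matrix is
  diagonal and invertible, which every elimination step preserves; the series \<open>H\<close> stay
  fixed.\<close>

lemma linear_system_rational:
  fixes M :: "'s \<Rightarrow> 's \<Rightarrow> 'x::finite multidegree \<Rightarrow>\<^sub>0 rat"
  assumes "finite S" "r \<in> S"
    and "\<And>s t. s \<in> S \<Longrightarrow> t \<in> S \<Longrightarrow> Poly_Mapping.lookup (M s t) 0 \<noteq> 0 \<longleftrightarrow> s = t"
    and "\<And>s \<alpha>. s \<in> S \<Longrightarrow>
      (\<Sum>t\<in>S. series_mult (M s t) (H t) \<alpha>) = Poly_Mapping.lookup (b s) \<alpha>"
  shows "\<exists>P Q. Poly_Mapping.lookup Q 0 \<noteq> 0 \<and> series_mult Q (H r) = Poly_Mapping.lookup P"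
  using assms
proof (induction "card S" arbitrary: S M b)
  case 0
  then show ?case by simp
next
  case (Suc n)
  show ?case
  proof (cases "S = {r}")
    case True
    \<comment> \<open>The one remaining equation has the required form, with \<open>M r r\<close> as
      \<open>Q\<close> and \<open>b r\<close> as \<open>P\<close>.\<close>
    then show ?thesis using Suc.prems(3,4)[of r] by (auto simp: fun_eq_iff)
  next
    case False
    then obtain p where p: "p \<in> S" "p \<noteq> r" using Suc.prems(2) by blast
    \<comment> \<open>Row \<open>s\<close> times the pivot \<open>M p p\<close>, minus row
      \<open>p\<close> times \<open>M s p\<close>: this clears column \<open>p\<close> without
      division.\<close>
    define M' where "M' s t = M p p * M s t - M s p * M p t" for s t
    define b' where "b' s = M p p * b s - M s p * b p" for s
    show ?thesis
    proof (rule Suc.hyps(1)[of "S - {p}" M' b'])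
      show "n = card (S - {p})" using Suc.hyps(2) p(1) by simp
      show "finite (S - {p})" "r \<in> S - {p}" using Suc.prems p by auto
    next
      fix s t assume "s \<in> S - {p}" "t \<in> S - {p}"
      \<comment> \<open>As \<open>s\<close> differs from \<open>p\<close>, the constant term of
        \<open>M s p\<close> is zero, so that of \<open>M' s t\<close> is the one of
        \<open>M s t\<close> times the nonzero one of the pivot.\<close>
      then show "Poly_Mapping.lookup (M' s t) 0 \<noteq> 0 \<longleftrightarrow> s = t"
        using Suc.prems(3)[of s t] Suc.prems(3)[of s p] Suc.prems(3)[of p p] p
        by (auto simp: M'_def lookup_minus lookup_mult_zero)
    next
      fix s \<alpha> assume s: "s \<in> S - {p}"
      have row: "series_mult Q (Poly_Mapping.lookup (b s)) \<alpha>
          = (\<Sum>t\<in>S. series_mult (Q * M s t) (H t) \<alpha>)" if "s \<in> S" for s Q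
      proof -
        have "Poly_Mapping.lookup (b s) = (\<lambda>\<alpha>. \<Sum>t\<in>S. series_mult (M s t) (H t) \<alpha>)"
          using Suc.prems(4)[OF that] by (simp add: fun_eq_iff)
        then show ?thesis by (simp only: series_mult_sum_right series_mult_mult)
      qed
      have "Poly_Mapping.lookup (b' s) \<alpha> = (\<Sum>t\<in>S. series_mult (M' s t) (H t) \<alpha>)"
        using s p row[of s "M p p"] row[of p "M s p"]
        by (simp add: b'_def M'_def lookup_minus series_mult_lookup series_mult_diff_left
            sum_subtractf)
      \<comment> \<open>The term for \<open>p\<close> drops out, since \<open>M' s p\<close> is zero
        by commutativity.\<close>
      also have "\<dots> = (\<Sum>t\<in>S - {p}. series_mult (M' s t) (H t) \<alpha>)"
        using Suc.prems(1) p(1) by (simp add: sum.remove M'_def mult.commute)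
      finally show "(\<Sum>t\<in>S - {p}. series_mult (M' s t) (H t) \<alpha>) = Poly_Mapping.lookup (b' s) \<alpha>" ..
    qed
  qed
qed

section \<open>Counting normal words along the orbit\<close>

text \<open>For monomial \<open>I\<close> this is the Hilbert series of the unshifted module; the
  shift \<delta> enters only as a monomial factor.\<close>

definition normal_words_series ::
    "('x, 'k::field) free_algebra set \<Rightarrow> 'x multidegree \<Rightarrow> rat" where
  "normal_words_series I \<alpha> = of_nat (card {w. word w \<notin> I \<and> word_deg w = \<alpha>})"

text \<open>The factor adds \<beta> to the degree of every word. It is applied both to the shift
  \<delta> and to a split-off first letter.\<close>

lemma series_mult_normal_words:
  fixes I :: "('x::finite, 'k::field) free_algebra set"
  shows "series_mult (Poly_Mapping.single \<beta> 1) (normal_words_series I) \<alpha>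
    = of_nat (card {w. word w \<notin> I \<and> \<beta> + word_deg w = \<alpha>})"
proof (cases "\<exists>\<gamma>. \<alpha> = \<beta> + \<gamma>")
  case True
  then show ?thesis by (auto simp: series_mult_single normal_words_series_def)
next
  case False
  then have "{w. word w \<notin> I \<and> \<beta> + word_deg w = \<alpha>} = {}" by auto
  then have "card {w. word w \<notin> I \<and> \<beta> + word_deg w = \<alpha>} = 0" by (simp only: card.empty)
  with False show ?thesis by (simp add: series_mult_single_0)
qed

lemma hilbert_series_cyclic_module:
  fixes I :: "('x::finite, 'k::field) free_algebra set"
  assumes "I \<in> monomial_right_ideals"
  shows "hilbert_series (cyclic_module \<delta> I)
    = series_mult (Poly_Mapping.single \<delta> 1) (normal_words_series I)"
  by (simp add: fun_eq_iff hilbert_series_def dim_cyclic_module[OF assms] series_mult_normal_words)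

lemma word_deg_Nil [simp]: "word_deg [] = 0"
  by (rule poly_mapping_eqI) (simp add: word_deg.rep_eq)

lemma word_deg_Cons: "word_deg (x # w) = Poly_Mapping.single x 1 + word_deg w"
  by (rule poly_mapping_eqI) (simp add: word_deg.rep_eq lookup_add lookup_single when_def)

text \<open>A nonempty word outside \<open>I\<close> has a unique first letter \<open>x\<close> and
  a rest outside \<open>colon_right I x\<close>, which gives the monomial factor of
  \<open>x\<close>. The empty word, when outside \<open>I\<close>, gives the term 1.\<close>

lemma normal_words_series_rec:
  fixes I :: "('x::finite, 'k::field) free_algebra set"
  shows "normal_words_series I \<alpha> = Poly_Mapping.lookup (if word [] \<in> I then 0 else 1) \<alpha>
    + (\<Sum>x\<in>UNIV. series_mult (Poly_Mapping.single (Poly_Mapping.single x 1) 1)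
        (normal_words_series (colon_right I x)) \<alpha>)"
proof -
  define E where "E = {w. w = [] \<and> word w \<notin> I \<and> word_deg w = \<alpha>}"
  define C where "C x = {w. word w \<notin> colon_right I x \<and> Poly_Mapping.single x 1 + word_deg w = \<alpha>}" for x
  have finC: "finite (C x)" for x
    unfolding C_def
    by (rule finite_subset[OF _ finite_words_of_degree[of "Poly_Mapping.single x 1" \<alpha>]]) auto
  have normal_Cons: "word w \<notin> colon_right I x \<longleftrightarrow> word (x # w) \<notin> I" for x w
    by (simp add: colon_right_def flip: word_append)
  have "{w. word w \<notin> I \<and> word_deg w = \<alpha>} = E \<union> (\<Union>x. (#) x ` C x)" (is "?L = ?R")
  proof (rule Set.set_eqI)
    fix w show "w \<in> ?L \<longleftrightarrow> w \<in> ?R"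
      by (cases w) (auto simp: E_def C_def normal_Cons word_deg_Cons)
  qed
  moreover have "card (E \<union> (\<Union>x. (#) x ` C x)) = card E + card (\<Union>x. (#) x ` C x)"
    by (rule card_Un_disjoint) (auto simp: E_def finC)
  moreover have "card (\<Union>x. (#) x ` C x) = (\<Sum>x\<in>UNIV. card ((#) x ` C x))"
    by (rule card_UN_disjoint) (auto simp: finC)
  moreover have "card ((#) x ` C x) = card (C x)" for x
    by (rule card_image) simp
  moreover have "E = (if word [] \<notin> I \<and> \<alpha> = 0 then {[]} else {})"
    by (auto simp: E_def)
  ultimately show ?thesis
    by (simp add: normal_words_series_def[of I] series_mult_normal_words C_def lookup_one)
qed

text \<open>A set closed under \<open>colon_right\<close> is the state set of a deterministic
  automaton, with a transition from \<open>J\<close> to \<open>colon_right J x\<close> on the letter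
  \<open>x\<close>. Its series satisfy (1 - A) H = b, where A is the transition matrix weighted by
  the variables.\<close>

lemma normal_words_series_rational:
  fixes I :: "('x::finite, 'k::field) free_algebra set"
  assumes "finite S" "I \<in> S" and colon: "\<And>J x. J \<in> S \<Longrightarrow> colon_right J x \<in> S"
  shows "\<exists>P Q. Poly_Mapping.lookup Q 0 \<noteq> 0
    \<and> series_mult Q (normal_words_series I) = Poly_Mapping.lookup P"
proof -
  define X where "X x = Poly_Mapping.single (Poly_Mapping.single x (1 :: nat)) (1 :: rat)" for x :: 'x
  define A where "A J K = (\<Sum>x\<in>UNIV. if colon_right J x = K then X x else 0)"
    for J K :: "('x, 'k) free_algebra set"
  define M where "M J K = (if J = K then 1 else 0) - A J K" for J K
  define b where "b J = (if word [] \<in> J then 0 else 1 :: 'x multidegree \<Rightarrow>\<^sub>0 rat)"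
    for J :: "('x, 'k) free_algebra set"
  show ?thesis
  proof (rule linear_system_rational[of S I M normal_words_series b, OF assms(1,2)])
    fix J K
    \<comment> \<open>Every transition weight has a nonzero exponent, so \<open>A\<close> has no
      constant terms and \<open>M\<close> has those of the identity.\<close>
    have "Poly_Mapping.single x (1 :: nat) \<noteq> 0" for x :: 'x
      by (metis lookup_single_eq lookup_zero zero_neq_one)
    then have "Poly_Mapping.lookup (X x) 0 = 0" for x
      by (simp add: X_def lookup_single)
    then have "Poly_Mapping.lookup (A J K) 0 = 0"
      by (auto simp: A_def lookup_sum intro!: sum.neutral)
    then show "Poly_Mapping.lookup (M J K) 0 \<noteq> 0 \<longleftrightarrow> J = K"
      by (simp add: M_def lookup_minus)
  next
    fix J \<alpha> assume J: "J \<in> S"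
    have "(\<Sum>K\<in>S. series_mult (A J K) (normal_words_series K) \<alpha>)
        = (\<Sum>x\<in>UNIV. \<Sum>K\<in>S. if colon_right J x = K then series_mult (X x) (normal_words_series K) \<alpha> else 0)"
      unfolding A_def series_mult_sum_left
      by (subst sum.swap) (auto intro!: sum.cong)
    \<comment> \<open>For each letter exactly one \<open>K\<close> contributes, and closure places
      it in \<open>S\<close>.\<close>
    also have "\<dots> = (\<Sum>x\<in>UNIV. series_mult (X x) (normal_words_series (colon_right J x)) \<alpha>)"
      using assms(1) colon[OF J] by simp
    also have "\<dots> = normal_words_series J \<alpha> - Poly_Mapping.lookup (b J) \<alpha>"
      by (simp add: X_def b_def normal_words_series_rec[of J])
    also have "normal_words_series J \<alpha>
        = (\<Sum>K\<in>S. series_mult (if J = K then 1 else 0) (normal_words_series K) \<alpha>)"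
    proof -
      have "(\<Sum>K\<in>S. series_mult (if J = K then 1 else 0) (normal_words_series K) \<alpha>)
          = (\<Sum>K\<in>S. if J = K then normal_words_series K \<alpha> else 0)"
        by (rule sum.cong) auto
      with J assms(1) show ?thesis by simp
    qed
    finally show "(\<Sum>K\<in>S. series_mult (M J K) (normal_words_series K) \<alpha>)
        = Poly_Mapping.lookup (b J) \<alpha>"
      by (simp add: M_def series_mult_diff_left sum_subtractf)
  qed
qed

lemma orbit_self: "I \<in> orbit I"
  by (simp add: orbit_def)

lemma orbit_colon_right: "J \<in> orbit I \<Longrightarrow> colon_right J x \<in> orbit I"
  by (simp add: orbit_def)

theorem theorem5p5:
  fixes \<delta> :: "'x::{finite,linorder} multidegree"
    and I :: "('x, 'k::field) free_algebra set"
  assumes "I \<in> monomial_right_ideals"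
    and "regular_ideal I"
  shows "\<exists>r. is_expansion (hilbert_series (cyclic_module \<delta> I)) r"
proof -
  obtain P Q where Q: "Poly_Mapping.lookup Q 0 \<noteq> 0"
    and QP: "series_mult Q (normal_words_series I) = Poly_Mapping.lookup P"
    using normal_words_series_rational[of "orbit I" I] assms(2)
    by (auto simp: regular_ideal_def orbit_self orbit_colon_right)
  \<comment> \<open>The shift commutes with \<open>Q\<close>, so the denominator stays the same and
    the numerator gains the monomial with exponent \<delta>.\<close>
  have "series_mult Q (hilbert_series (cyclic_module \<delta> I))
      = series_mult (Poly_Mapping.single \<delta> 1) (series_mult Q (normal_words_series I))"
    unfolding hilbert_series_cyclic_module[OF assms(1)]
    by (simp add: mult.commute flip: series_mult_mult)
  also have "\<dots> = Poly_Mapping.lookup (Poly_Mapping.single \<delta> 1 * P)"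
    by (simp add: QP series_mult_lookup)
  finally have "is_expansion (hilbert_series (cyclic_module \<delta> I))
      (Fract (Poly_Mapping.single \<delta> 1 * P) Q)"
    using Q unfolding is_expansion_def fun_eq_iff series_mult_def by blast
  then show ?thesis ..
qed

end
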